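(* Let $(u_h^n)_{n\ge 0}\subset V_h$ be a sequence produced by the Dual Characteristic-Galerkin method (DCGM), i.e. $u_h^0\in V_h$ and, for every $n\ge 1$, $u_h^n\in V_h$ satisfies $$\int_\Omega \big(u^n_h \hat u_h + \delta t\,\nu\nabla u^n_h\cdot \nabla\hat u_h \big) = \sum_{i\in I} u^{n-1}_h(\xi^i)\,\hat u_h(\eta^i)\,\omega^i \qquad \forall\, \hat u_h\in V_h .$$ Then DCGM conserves mass in the sense that $$\int_\Omega u_h^n=\int_\Omega u_h^0\qquad\text{for all } n .$$
   Context: Let $\nu>0$, $T>0$, $d\in\{2,3\}$, and let $\Omega\subset\mathbb{R}^d$ be a bounded open polygonal (polyhedral) domain, covered by a triangulation $\bigcup_k T^k$ into simplices ("triangles"). Let $\delta t>0$ be the time step. $V_h$ is the space of continuous functions on $\overline\Omega$ that are affine on each $T^k$ (continuous $P^1$ finite elements). Velocity field: $a:\Omega\times(0,T)\to\mathbb{R}^d$ is smooth, with $\nabla\cdot a=0$ in $\Omega$ and $a\cdot \mathbf n=0$ on $\partial\Omega$ ($\mathbf n$ the normal). The time argument is suppressed: in the $n$-th time step, with $t^n=n\,\delta t$, $a(x)$ denotes $a(x,\tau_n)$ for a fixed time $\tau_n\in[t^{n-1},t^n]$ ($a$ being smooth up to the boundary of $\Omega\times(0,T)$). $\bar a$ is the extension of $a$ by zero outside $\Omega$; with $\dot\eta(t)=\bar a(\eta(t))$, $\eta(0)=x$, one sets $\eta^{\pm}(x)=\eta(\pm\delta t)$. Quadrature: the points $\{\xi^i\}_{i\in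 I}$ and positive weights $\{\omega^i\}_{i\in I}$ define a quadrature rule on $\Omega$ which is exact at least for continuous piecewise-$P^2$ functions on the triangulation. It is defined triangle by triangle, $\sum_{i\in I} f(\xi^i)\omega^i:=\sum_k\sum_{i\in I(T^k)} f(\xi^i)\omega^i_k$, $I=\bigcup_k I(T^k)$, with $\xi^i\in T^k$ for $i\in I(T^k)$. The points $\eta^i\in\Omega$ approximate $\eta^+(\xi^i)$: $|\eta^i-\eta^+(\xi^i)|\le C\,\delta t^2$ (for example $\eta^i=\eta_a^+(\xi^i)$ with $\eta_a^+(x)=x+a(x)\delta t+\frac{\sigma}{2}\delta t^2\,a(x)\cdot\nabla a(x)$, $\sigma\in\{0,1\}$). The method discretizes $\partial_t u+a\cdot\nabla u-\nu\Delta u=0$ in $\Omega$, $u(0)=u^0$, with $\partial_n u=0$ on $\partial\Omega$. *)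

theory Defs
  imports "HOL-Analysis.Analysis"
begin

subsection \<open>Domain and mesh\<close>

text \<open>The boundary pieces are segments (\<open>d = 2\<close>) or flat convex polygons (\<open>d = 3\<close>).\<close>

definition polyhedral_domain :: "(real^'n) set \<Rightarrow> bool" where
  "polyhedral_domain \<Omega> \<longleftrightarrow> \<Omega> \<noteq> {} \<and> open \<Omega> \<and> connected \<Omega> \<and> bounded \<Omega> \<and>
     (\<exists>F. finite F \<and> (\<forall>P\<in>F. polytope P \<and> aff_dim P = int CARD('n) - 1) \<and> frontier \<Omega> = \<Union>F)"

text \<open>Unit normals (of either sign) at the boundary points near which the boundary is flat; these
  are all boundary points except those on lower-dimensional edges and vertices.\<close>

definition unit_normal_at :: "(real^'n) set \<Rightarrow> real^'n \<Rightarrow> real^'n \<Rightarrow> bool" where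
  "unit_normal_at \<Omega> x n \<longleftrightarrow> x \<in> frontier \<Omega> \<and> norm n = 1 \<and>
     (\<exists>e>0. frontier \<Omega> \<inter> ball x e = {y \<in> ball x e. n \<bullet> (y - x) = 0})"

text \<open>The library's notion of triangulation is the conforming one: two simplices meet in a
  common (possibly empty) face.\<close>

definition mesh_of :: "(real^'n) set \<Rightarrow> (real^'n) set set \<Rightarrow> bool" where
  "mesh_of \<Omega> \<T> \<longleftrightarrow> triangulation \<T> \<and> (\<forall>T\<in>\<T>. int CARD('n) simplex T) \<and> \<Union>\<T> = closure \<Omega>"

subsection \<open>Finite element spaces\<close>

text \<open>Elements are total functions, of which only the values on \<open>closure \<Omega>\<close> matter.\<close>

definition P1_space :: "(real^'n) set \<Rightarrow> (real^'n) set set \<Rightarrow> (real^'n \<Rightarrow> real) set" where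
  "P1_space \<Omega> \<T> = {v. continuous_on (closure \<Omega>) v \<and>
     (\<forall>T\<in>\<T>. \<exists>b c. \<forall>x\<in>T. v x = b \<bullet> x + c)}"

definition P2_space :: "(real^'n) set \<Rightarrow> (real^'n) set set \<Rightarrow> (real^'n \<Rightarrow> real) set" where
  "P2_space \<Omega> \<T> = {v. continuous_on (closure \<Omega>) v \<and>
     (\<forall>T\<in>\<T>. \<exists>(A :: real^'n^'n) b c. \<forall>x\<in>T. v x = x \<bullet> (A *v x) + b \<bullet> x + c)}"

text \<open>For a function in \<open>P1_space \<Omega> \<T>\<close> the gradient is defined off the interfaces between
  the simplices, hence almost everywhere in \<open>\<Omega>\<close>.\<close>

definition grad :: "(real^'n \<Rightarrow> real) \<Rightarrow> real^'n \<Rightarrow> real^'n" where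
  "grad f x = (\<chi> i. frechet_derivative f (at x) (axis i 1))"

subsection \<open>Velocity field and characteristics\<close>

primrec iterated_derivative ::
    "'a::real_normed_vector list \<Rightarrow> ('a \<Rightarrow> 'b::real_normed_vector) \<Rightarrow> 'a \<Rightarrow> 'b" where
  "iterated_derivative [] f = f"
| "iterated_derivative (v # vs) f =
     (\<lambda>x. frechet_derivative (iterated_derivative vs f) (at x) v)"

text \<open>Infinitely differentiable on the open set \<open>S\<close>, and every derivative extends continuously
  to \<open>closure S\<close>; the extension of \<open>f\<close> is given by the values of \<open>f\<close> on \<open>closure S\<close>.\<close>

definition smooth_up_to_boundary ::
    "'a::real_normed_vector set \<Rightarrow> ('a \<Rightarrow> 'b::real_normed_vector) \<Rightarrow> bool" where
  "smooth_up_to_boundary S f \<longleftrightarrow> continuous_on (closure S) f \<and>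
     (\<forall>vs. (\<forall>x\<in>S. iterated_derivative vs f differentiable (at x)) \<and>
           (\<exists>g. continuous_on (closure S) g \<and> (\<forall>x\<in>S. g x = iterated_derivative vs f x)))"

definition divergence :: "(real^'n \<Rightarrow> real^'n) \<Rightarrow> real^'n \<Rightarrow> real" where
  "divergence b x = (\<Sum>i\<in>UNIV. frechet_derivative b (at x) (axis i 1) $ i)"

text \<open>On the boundary of \<open>\<Omega>\<close> the extension keeps the boundary values of \<open>b\<close>.\<close>

definition zero_extension :: "(real^'n) set \<Rightarrow> (real^'n \<Rightarrow> real^'n) \<Rightarrow> real^'n \<Rightarrow> real^'n" where
  "zero_extension \<Omega> b x = (if x \<in> closure \<Omega> then b x else 0)"

definition characteristic :: "(real^'n \<Rightarrow> real^'n) \<Rightarrow> real^'n \<Rightarrow> (real \<Rightarrow> real^'n) \<Rightarrow> bool" where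
  "characteristic b x \<gamma> \<longleftrightarrow>
     \<gamma> 0 = x \<and> (\<forall>t. (\<gamma> has_vector_derivative b (\<gamma> t)) (at t))"

subsection \<open>Quadrature\<close>

text \<open>\<open>J T\<close> is the set of indices of the nodes used on the simplex \<open>T\<close>, and \<open>w T i\<close> the weight
  of node \<open>i\<close> in the rule on \<open>T\<close>. A node shared by several simplices gets the sum of its weights.\<close>

definition nodes :: "'s set \<Rightarrow> ('s \<Rightarrow> 'i set) \<Rightarrow> 'i set" where
  "nodes \<T> J = (\<Union>T\<in>\<T>. J T)"

definition weight :: "'s set \<Rightarrow> ('s \<Rightarrow> 'i set) \<Rightarrow> ('s \<Rightarrow> 'i \<Rightarrow> real) \<Rightarrow> 'i \<Rightarrow> real" where
  "weight \<T> J w i = (\<Sum>T\<in>{T \<in> \<T>. i \<in> J T}. w T i)"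

lemma sum_nodes_weight:
  assumes "finite \<T>" "\<And>T. T \<in> \<T> \<Longrightarrow> finite (J T)"
  shows "(\<Sum>i\<in>nodes \<T> J. g i * weight \<T> J w i) = (\<Sum>T\<in>\<T>. \<Sum>i\<in>J T. g i * w T i)"
proof -
  have fin: "finite (nodes \<T> J)"
    using assms by (simp add: nodes_def)
  have "(\<Sum>i\<in>nodes \<T> J. g i * weight \<T> J w i)
      = (\<Sum>i\<in>nodes \<T> J. \<Sum>T\<in>\<T>. if i \<in> J T then g i * w T i else 0)"
    using assms(1)
    by (auto simp: weight_def sum_distrib_left sum.inter_filter intro!: sum.cong)
  also have "\<dots> = (\<Sum>T\<in>\<T>. \<Sum>i\<in>nodes \<T> J. if i \<in> J T then g i * w T i else 0)"
    by (rule sum.swap)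
  also have "\<dots> = (\<Sum>T\<in>\<T>. \<Sum>i\<in>J T. g i * w T i)"
  proof (rule sum.cong[OF refl])
    fix T assume "T \<in> \<T>"
    then have "{i \<in> nodes \<T> J. i \<in> J T} = J T"
      by (auto simp: nodes_def)
    then show "(\<Sum>i\<in>nodes \<T> J. if i \<in> J T then g i * w T i else 0) = (\<Sum>i\<in>J T. g i * w T i)"
      using sum.inter_filter[OF fin, of "\<lambda>i. g i * w T i" "\<lambda>i. i \<in> J T"] by simp
  qed
  finally show ?thesis .
qed

definition quadrature_rule ::
    "(real^'n) set set \<Rightarrow> ((real^'n) set \<Rightarrow> 'i set) \<Rightarrow> ((real^'n) set \<Rightarrow> 'i \<Rightarrow> real)
      \<Rightarrow> ('i \<Rightarrow> real^'n) \<Rightarrow> bool" where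
  "quadrature_rule \<T> J w \<xi> \<longleftrightarrow>
     (\<forall>T\<in>\<T>. finite (J T) \<and> (\<forall>i\<in>J T. \<xi> i \<in> T)) \<and> (\<forall>i\<in>nodes \<T> J. weight \<T> J w i > 0)"

definition exact_for ::
    "(real^'n) set \<Rightarrow> (real^'n) set set \<Rightarrow> ((real^'n) set \<Rightarrow> 'i set)
      \<Rightarrow> ((real^'n) set \<Rightarrow> 'i \<Rightarrow> real) \<Rightarrow> ('i \<Rightarrow> real^'n) \<Rightarrow> (real^'n \<Rightarrow> real) set \<Rightarrow> bool" where
  "exact_for \<Omega> \<T> J w \<xi> V \<longleftrightarrow>
     (\<forall>f\<in>V. (\<Sum>i\<in>nodes \<T> J. f (\<xi> i) * weight \<T> J w i) = (LINT x:\<Omega>|lebesgue. f x))"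

end

theory Submission
  imports Defs
begin

text \<open>
  Mass is conserved because the constant function \<open>1\<close> is an admissible test function and takes the
  same value at every foot \<open>\<eta> n i\<close>. Testing with it removes the diffusion term, and the transport
  term becomes the quadrature sum of \<open>u (n - 1)\<close> itself. The rule evaluates
  that sum exactly, since piecewise affine functions are piecewise quadratic. Each time step
  therefore leaves the integral unchanged.
\<close>

lemma const_in_P1_space: "(\<lambda>x. k) \<in> P1_space \<Omega> \<T>"
  unfolding P1_space_def by (auto intro: exI[where x = 0] exI[where x = k])

lemma grad_const: "grad (\<lambda>x. k) x = 0"
  by (simp add: grad_def vec_eq_iff)

lemma P1_space_subset_P2_space:
  fixes \<Omega> :: "(real^'n) set"
  shows "P1_space \<Omega> \<T> \<subseteq> P2_space \<Omega> \<T>"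
proof
  fix v :: "real^'n \<Rightarrow> real" assume v: "v \<in> P1_space \<Omega> \<T>"
  have "\<exists>(A :: real^'n^'n) b c. \<forall>x\<in>T. v x = x \<bullet> (A *v x) + b \<bullet> x + c" if "T \<in> \<T>" for T
  proof -
    from v that obtain b c where "\<forall>x\<in>T. v x = b \<bullet> x + c"
      unfolding P1_space_def by blast
    then have "\<forall>x\<in>T. v x = x \<bullet> ((0 :: real^'n^'n) *v x) + b \<bullet> x + c"
      by simp
    then show ?thesis by blast
  qed
  with v show "v \<in> P2_space \<Omega> \<T>"
    unfolding P1_space_def P2_space_def by blast
qed

theorem proposition1:
  fixes \<Omega> :: "(real^'n) set"
    and \<T> :: "(real^'n) set set"
    and a :: "real^'n \<Rightarrow> real \<Rightarrow> real^'n"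
    and \<nu> Tend \<delta>t C :: real
    and \<tau> :: "nat \<Rightarrow> real"
    and X :: "nat \<Rightarrow> real^'n \<Rightarrow> real \<Rightarrow> real^'n"
    and J :: "(real^'n) set \<Rightarrow> 'i set"
    and w :: "(real^'n) set \<Rightarrow> 'i \<Rightarrow> real"
    and \<xi> :: "'i \<Rightarrow> real^'n"
    and \<eta> :: "nat \<Rightarrow> 'i \<Rightarrow> real^'n"
    and u :: "nat \<Rightarrow> real^'n \<Rightarrow> real"
  assumes dim: "CARD('n) \<in> {2, 3}"
    and pos: "\<nu> > 0" "Tend > 0" "\<delta>t > 0"
    and domain: "polyhedral_domain \<Omega>"
    and mesh: "mesh_of \<Omega> \<T>"
    and smooth: "smooth_up_to_boundary (\<Omega> \<times> {0<..<Tend}) (\<lambda>(x, t). a x t)"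
    and div_free: "\<forall>t\<in>{0<..<Tend}. \<forall>x\<in>\<Omega>. divergence (\<lambda>y. a y t) x = 0"
    and tangential: "\<forall>t\<in>{0<..<Tend}. \<forall>x n. unit_normal_at \<Omega> x n \<longrightarrow> a x t \<bullet> n = 0"
    and frozen_time: "\<forall>n\<ge>1. \<tau> n \<in> {real (n - 1) * \<delta>t .. real n * \<delta>t}"
    and characteristics: "\<forall>n\<ge>1. real n * \<delta>t \<le> Tend \<longrightarrow>
      (\<forall>x\<in>closure \<Omega>. characteristic (zero_extension \<Omega> (\<lambda>y. a y (\<tau> n))) x (X n x))"
    and quadrature: "quadrature_rule \<T> J w \<xi>"
    and exact: "exact_for \<Omega> \<T> J w \<xi> (P2_space \<Omega> \<T>)"
    and feet: "\<forall>n\<ge>1. \<forall>i\<in>nodes \<T> J. \<eta> n i \<in> \<Omega>"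
    and feet_approx: "\<forall>n\<ge>1. real n * \<delta>t \<le> Tend \<longrightarrow>
      (\<forall>i\<in>nodes \<T> J. norm (\<eta> n i - X n (\<xi> i) \<delta>t) \<le> C * \<delta>t\<^sup>2)"
    and in_space: "\<forall>n. u n \<in> P1_space \<Omega> \<T>"
    and dcgm: "\<forall>n\<ge>1. \<forall>v\<in>P1_space \<Omega> \<T>.
      (LINT x:\<Omega>|lebesgue. u n x * v x + \<delta>t * \<nu> * (grad (u n) x \<bullet> grad v x))
        = (\<Sum>i\<in>nodes \<T> J. u (n - 1) (\<xi> i) * v (\<eta> n i) * weight \<T> J w i)"
  shows "\<forall>n. (LINT x:\<Omega>|lebesgue. u n x) = (LINT x:\<Omega>|lebesgue. u 0 x)"
proof
  have step: "(LINT x:\<Omega>|lebesgue. u (Suc n) x) = (LINT x:\<Omega>|lebesgue. u n x)" for n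
  proof -
    have "(LINT x:\<Omega>|lebesgue. u (Suc n) x)
        = (LINT x:\<Omega>|lebesgue. u (Suc n) x * 1
            + \<delta>t * \<nu> * (grad (u (Suc n)) x \<bullet> grad (\<lambda>_. 1) x))"
      by (simp add: grad_const)
    also have "\<dots> = (\<Sum>i\<in>nodes \<T> J. u n (\<xi> i) * weight \<T> J w i)"
      using dcgm[rule_format, of "Suc n" "\<lambda>_. 1", OF _ const_in_P1_space] by simp
    also have "\<dots> = (LINT x:\<Omega>|lebesgue. u n x)"
      using exact in_space P1_space_subset_P2_space unfolding exact_for_def by blast
    finally show ?thesis .
  qed
  show "(LINT x:\<Omega>|lebesgue. u n x) = (LINT x:\<Omega>|lebesgue. u 0 x)" for n
    by (induction n) (simp_all add: step)
qed

end
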